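(* The set $\mathcal{LP}_4$ is formed by exactly two isotopism classes, which are respectively the sets $\mathcal{LP}_{4,1}\sqcup\mathcal{LP}_{4,2}$ and $\mathcal{LP}_{4,4}$.
   Context: $\mathbb{F}_4$ is the field with four elements. $\mathcal{P}_4$ is the set of polynomials in $\mathbb{F}_4[x]$ of degree less than $4$ that act as permutations of $\mathbb{F}_4$. $\mathcal{LP}_4$ is the set of polynomials $f\in\mathbb{F}_4[x,y]$ of degree less than $4$ in each variable such that, for every $a\in\mathbb{F}_4$, both $f(x,a)$ and $f(a,x)$ act as permutations of $\mathbb{F}_4$. $\mathcal{LP}_{4,d}$ is the subset of polynomials of total degree $d$ in $\mathcal{LP}_4$. A polynomial $f\in\mathcal{LP}_4$ is isotopic to $g\in\mathcal{LP}_4$ if $g(h_1(x),h_2(y))=h_3(f(x,y))$ for some $h_1,h_2,h_3\in\mathcal{P}_4$, compositions being taken modulo $x^4-x$ and $y^4-y$; this is an equivalence relation, whose classes are called isotopism classes. *)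

theory Defs
  imports "HOL-Computational_Algebra.Polynomial"
begin

text \<open>
  A polynomial in two variables \<open>x\<close> and \<open>y\<close> over \<open>'a\<close> is an element of \<open>'a poly poly\<close>, read as
  \<open>F[x][y]\<close>: the inner variable is \<open>x\<close>, the outer one is \<open>y\<close>, and the coefficient of
  \<open>x^i y^j\<close> in \<open>f\<close> is \<open>coeff (coeff f j) i\<close>.
\<close>

definition subst_x :: "'a::field \<Rightarrow> 'a poly poly \<Rightarrow> 'a poly" where
  "subst_x a f = map_poly (\<lambda>p. poly p a) f"  \<comment> \<open>\<open>f(a, y)\<close>\<close>

definition subst_y :: "'a::field \<Rightarrow> 'a poly poly \<Rightarrow> 'a poly" where
  "subst_y a f = poly f [:a:]"  \<comment> \<open>\<open>f(x, a)\<close>\<close>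

text \<open>By the usual library convention for \<open>degree\<close>, the zero polynomial gets total degree 0.\<close>

definition total_degree :: "'a::field poly poly \<Rightarrow> nat" where
  "total_degree f = Max (insert 0 {i + j |i j. coeff (coeff f j) i \<noteq> 0})"

definition permutation_poly :: "'a::field poly \<Rightarrow> bool" where
  "permutation_poly h \<longleftrightarrow> bij (poly h)"

definition P4 :: "'a::field poly set" where
  "P4 = {h. degree h < 4 \<and> permutation_poly h}"

definition LP4 :: "'a::field poly poly set" where
  "LP4 = {f. degree f < 4 \<and> (\<forall>j. degree (coeff f j) < 4) \<and>
             (\<forall>a. permutation_poly (subst_y a f) \<and> permutation_poly (subst_x a f))}"

definition LP4_deg :: "nat \<Rightarrow> 'a::field poly poly set" where
  "LP4_deg d = {f \<in> LP4. total_degree f = d}"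

definition var_x :: "'a::field poly poly" where
  "var_x = [:[:0, 1:]:]"

definition var_y :: "'a::field poly poly" where
  "var_y = [:0, 1:]"

text \<open>Congruence modulo the ideal of \<open>F[x, y]\<close> generated by \<open>x^4 - x\<close> and \<open>y^4 - y\<close>.\<close>

definition cong4 :: "'a::field poly poly \<Rightarrow> 'a poly poly \<Rightarrow> bool" where
  "cong4 f g \<longleftrightarrow> (\<exists>A B. f - g = A * (var_x ^ 4 - var_x) + B * (var_y ^ 4 - var_y))"

text \<open>
  \<open>compose_in g h1 h2\<close> is \<open>g(h1(x), h2(y))\<close>: \<open>h1\<close> is substituted for \<open>x\<close> in every coefficient
  of \<open>g\<close>, and \<open>h2\<close>, regarded as a polynomial in \<open>y\<close> with constant coefficients, for \<open>y\<close>.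
  \<open>compose_out h3 f\<close> is \<open>h3(f(x, y))\<close>.
\<close>

definition compose_in :: "'a::field poly poly \<Rightarrow> 'a poly \<Rightarrow> 'a poly \<Rightarrow> 'a poly poly" where
  "compose_in g h1 h2 = pcompose (map_poly (\<lambda>p. pcompose p h1) g) (map_poly (\<lambda>c. [:c:]) h2)"

definition compose_out :: "'a::field poly \<Rightarrow> 'a poly poly \<Rightarrow> 'a poly poly" where
  "compose_out h3 f = poly (map_poly (\<lambda>c. [:[:c:]:]) h3) f"

definition isotopic :: "'a::field poly poly \<Rightarrow> 'a poly poly \<Rightarrow> bool" where
  "isotopic f g \<longleftrightarrow>
     (\<exists>h1\<in>P4. \<exists>h2\<in>P4. \<exists>h3\<in>P4. cong4 (compose_in g h1 h2) (compose_out h3 f))"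

definition isotopism :: "('a::field poly poly \<times> 'a poly poly) set" where
  "isotopism = {(f, g). f \<in> LP4 \<and> g \<in> LP4 \<and> isotopic f g}"

end

theory Submission
  imports Defs
begin

text \<open>
  A polynomial reduced in both variables is determined by the operation it induces on the field, so
  the question is about Latin squares of order 4. After relabelling, such a square has identity
  first row and column. Either all its diagonal entries are then \<open>0\<close>, which forces the table of
  addition, or some nonzero \<open>p\<close> has \<open>p p = q \<noteq> 0\<close>, which forces the table of the cyclic group of
  order 4 with \<open>p\<close> as generator. The values of a permutation \<open>\<gamma>\<close> of the field sum to \<open>0\<close>, so
  \<open>\<gamma>(x + y) = \<gamma>(x) + \<gamma>(y) + \<gamma>(0)\<close>, and the squares isotopic to addition are exactly the
  functions of the form \<open>A(x) + B(y)\<close>.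

  On the polynomial side, the same vanishing sum shows that a permutation polynomial has no cubic
  term, and \<open>c\<^sub>0 + c\<^sub>1 x + c\<^sub>2 x^2\<close> permutes iff exactly one of \<open>c\<^sub>1\<close>, \<open>c\<^sub>2\<close> is nonzero. Writing
  \<open>f = c\<^sub>0(y) + c\<^sub>1(y) x + c\<^sub>2(y) x^2\<close>, the polynomials \<open>c\<^sub>1\<close> and \<open>c\<^sub>2\<close> have complementary
  supports, and counting zeros shows that without the term \<open>x^2 y^2\<close> all mixed terms vanish. Hence
  the form \<open>A(x) + B(y)\<close> occurs exactly in total degree 1 or 2, and the remaining polynomials
  have total degree 4.
\<close>

lemma bij_if_inj_finite:
  fixes f :: "'a \<Rightarrow> 'a"
  assumes "finite (UNIV :: 'a set)" "inj f"
  shows "bij f"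
  using assms finite_UNIV_inj_surj by (auto simp: bij_def)

section \<open>Polynomials in two variables as operations\<close>

definition ev :: "'a::field poly poly \<Rightarrow> 'a \<Rightarrow> 'a \<Rightarrow> 'a" where
  "ev f a b = poly (poly f [:b:]) a"

lemma ev_add [simp]: "ev (f + g) a b = ev f a b + ev g a b"
  and ev_diff [simp]: "ev (f - g) a b = ev f a b - ev g a b"
  and ev_mult [simp]: "ev (f * g) a b = ev f a b * ev g a b"
  and ev_power [simp]: "ev (f ^ n) a b = ev f a b ^ n"
  and ev_var_x [simp]: "ev var_x a b = a"
  and ev_var_y [simp]: "ev var_y a b = b"
  by (simp_all add: ev_def var_x_def var_y_def)

lemma poly_subst_y: "poly (subst_y b f) a = ev f a b"
  by (simp add: subst_y_def ev_def)

lemma poly_subst_x: "poly (subst_x a f) b = ev f a b"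
  by (induction f) (simp_all add: subst_x_def ev_def map_poly_pCons)

lemma ev_compose_in: "ev (compose_in g h1 h2) a b = ev g (poly h1 a) (poly h2 b)"
proof -
  have y: "poly (map_poly (\<lambda>c. [:c:]) h2) [:b:] = [:poly h2 b:]"
    by (induction h2) (simp_all add: map_poly_pCons mult.commute)
  have x: "poly (poly (map_poly (\<lambda>p. pcompose p h1) g) [:c:]) a = ev g (poly h1 a) c" for c
    by (induction g) (simp_all add: map_poly_pCons ev_def poly_pcompose)
  show ?thesis
    unfolding compose_in_def ev_def[of "pcompose _ _"] poly_pcompose y x ..
qed

lemma ev_compose_out: "ev (compose_out h f) a b = poly h (ev f a b)"
proof (induction h)
  case (pCons c h)
  then show ?case
    by (simp add: compose_out_def ev_def map_poly_pCons)
qed (simp add: compose_out_def ev_def)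

lemma ev_expand4:
  assumes "degree f < 4" "\<And>j. degree (coeff f j) < 4"
  shows "ev f a b = (\<Sum>j<4. (\<Sum>i<4. coeff (coeff f j) i * a ^ i) * b ^ j)"
proof -
  \<comment> \<open>Stated over any commutative semiring so that it serves twice: for
    \<open>f\<close> as a polynomial in \<open>y\<close> over the ring of polynomials in
    \<open>x\<close>, and for each coefficient in \<open>x\<close>.\<close>
  have p: "poly p x = (\<Sum>i<4. coeff p i * x ^ i)" if "degree p < 4" for p :: "'b::comm_semiring_1 poly" and x
    unfolding poly_altdef using that
    by (intro sum.mono_neutral_left) (auto simp: coeff_eq_0)
  show ?thesis
    unfolding ev_def p[OF assms(1)]
    by (simp add: poly_sum p[OF assms(2)])
qed

text \<open>The exponent of \<open>x\<close> comes first, although \<open>y\<close> is the outer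
  variable of the representation.\<close>

definition coef :: "'a::field poly poly \<Rightarrow> nat \<Rightarrow> nat \<Rightarrow> 'a" where
  "coef f i j = coeff (coeff f j) i"

text \<open>The invariant that tells the two isotopism classes apart.\<close>

definition separated :: "('a::field \<Rightarrow> 'a \<Rightarrow> 'a) \<Rightarrow> bool" where
  "separated F \<longleftrightarrow> (\<exists>A B. \<forall>x y. F x y = A x + B y)"

definition latin :: "('a \<Rightarrow> 'a \<Rightarrow> 'a) \<Rightarrow> bool" where
  "latin F \<longleftrightarrow> (\<forall>a. bij (F a)) \<and> (\<forall>b. bij (\<lambda>a. F a b))"

lemma LP4_iff:
  "f \<in> LP4 \<longleftrightarrow> degree f < 4 \<and> (\<forall>j. degree (coeff f j) < 4) \<and> latin (ev f)"
proof -
  have "poly (subst_x a f) = ev f a" "poly (subst_y a f) = (\<lambda>x. ev f x a)" for a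
    by (auto simp: poly_subst_x poly_subst_y)
  then show ?thesis
    by (auto simp: LP4_def permutation_poly_def latin_def)
qed

section \<open>Isotopy of operations\<close>

definition isotopic_ops :: "('a \<Rightarrow> 'a \<Rightarrow> 'a) \<Rightarrow> ('a \<Rightarrow> 'a \<Rightarrow> 'a) \<Rightarrow> bool" where
  "isotopic_ops F G \<longleftrightarrow>
     (\<exists>\<alpha> \<beta> \<gamma>. bij \<alpha> \<and> bij \<beta> \<and> bij \<gamma> \<and> (\<forall>x y. G (\<alpha> x) (\<beta> y) = \<gamma> (F x y)))"

lemma isotopic_ops_sym: "isotopic_ops F G \<Longrightarrow> isotopic_ops G F"
proof -
  assume "isotopic_ops F G"
  then obtain \<alpha> \<beta> \<gamma> where b: "bij \<alpha>" "bij \<beta>" "bij \<gamma>"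
    and e: "\<And>x y. G (\<alpha> x) (\<beta> y) = \<gamma> (F x y)"
    by (auto simp: isotopic_ops_def)
  have "F (inv \<alpha> x) (inv \<beta> y) = inv \<gamma> (G x y)" for x y
    using e[of "inv \<alpha> x" "inv \<beta> y"] b by (simp add: bij_is_surj surj_f_inv_f bij_is_inj)
  with b show "isotopic_ops G F"
    unfolding isotopic_ops_def by (meson bij_imp_bij_inv)
qed

lemma isotopic_ops_trans: "isotopic_ops F G \<Longrightarrow> isotopic_ops G H \<Longrightarrow> isotopic_ops F H"
proof -
  assume "isotopic_ops F G" "isotopic_ops G H"
  then obtain \<alpha> \<beta> \<gamma> \<alpha>' \<beta>' \<gamma>' where
    b: "bij \<alpha>" "bij \<beta>" "bij \<gamma>" "bij \<alpha>'" "bij \<beta>'" "bij \<gamma>'"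
    and e: "\<And>x y. G (\<alpha> x) (\<beta> y) = \<gamma> (F x y)" "\<And>x y. H (\<alpha>' x) (\<beta>' y) = \<gamma>' (G x y)"
    by (auto simp: isotopic_ops_def)
  show "isotopic_ops F H"
    unfolding isotopic_ops_def
    by (rule exI[of _ "\<alpha>' \<circ> \<alpha>"], rule exI[of _ "\<beta>' \<circ> \<beta>"], rule exI[of _ "\<gamma>' \<circ> \<gamma>"])
      (simp add: b e bij_comp)
qed

text \<open>Isotopy to addition modulo 4. The residues do not live in the type \<open>'a\<close>, so
  \<open>a\<close>, \<open>b\<close> and \<open>c\<close> label rows, columns and symbols by
  them.\<close>

definition cyclic :: "('a \<Rightarrow> 'a \<Rightarrow> 'a) \<Rightarrow> bool" where
  "cyclic F \<longleftrightarrow>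
     (\<exists>a b c. bij_betw a {..<4} UNIV \<and> bij_betw b {..<4} UNIV \<and> bij_betw c {..<4} UNIV \<and>
       (\<forall>i<4. \<forall>j<4. F (a i) (b j) = c ((i + j) mod 4 :: nat)))"

lemma cyclic_isotopic_ops:
  assumes "cyclic F" "cyclic G"
  shows "isotopic_ops F G"
proof -
  obtain a b c where F: "bij_betw a {..<4} UNIV" "bij_betw b {..<4} UNIV" "bij_betw c {..<4} UNIV"
    "\<forall>i<4. \<forall>j<4. F (a i) (b j) = c ((i + j) mod 4 :: nat)"
    using assms(1) unfolding cyclic_def by blast
  obtain a' b' c' where G: "bij_betw a' {..<4} UNIV" "bij_betw b' {..<4} UNIV" "bij_betw c' {..<4} UNIV"
    "\<forall>i<4. \<forall>j<4. G (a' i) (b' j) = c' ((i + j) mod 4 :: nat)"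
    using assms(2) unfolding cyclic_def by blast
  \<comment> \<open>\<open>t u v\<close> is the change of labelling that sends \<open>u i\<close> to
    \<open>v i\<close>.\<close>
  define t :: "(nat \<Rightarrow> 'a) \<Rightarrow> (nat \<Rightarrow> 'a) \<Rightarrow> 'a \<Rightarrow> 'a"
    where "t u v = v \<circ> the_inv_into {..<4} u" for u v
  have bij: "bij (t u v)" if "bij_betw u {..<4} UNIV" "bij_betw v {..<4} UNIV" for u v
    unfolding t_def using that by (meson bij_betw_the_inv_into bij_betw_trans)
  have t: "t u v (u i) = v i" if "bij_betw u {..<4} UNIV" "i < 4" for u v i
    using that by (simp add: t_def the_inv_into_f_f bij_betw_def)
  have "G (t a a' x) (t b b' y) = t c c' (F x y)" for x y
  proof -
    obtain i j where "x = a i" "i < 4" "y = b j" "j < 4"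
      using F(1,2) unfolding bij_betw_def by (metis UNIV_I imageE lessThan_iff)
    then show ?thesis
      using F G by (simp add: t)
  qed
  with bij F G show ?thesis
    unfolding isotopic_ops_def by meson
qed

lemma cyclic_if_isotopic_ops:
  assumes "isotopic_ops F G" "cyclic F"
  shows "cyclic G"
proof -
  obtain a b c where F: "bij_betw a {..<4} UNIV" "bij_betw b {..<4} UNIV" "bij_betw c {..<4} UNIV"
    "\<forall>i<4. \<forall>j<4. F (a i) (b j) = c ((i + j) mod 4 :: nat)"
    using assms(2) unfolding cyclic_def by blast
  obtain \<alpha> \<beta> \<gamma> where b: "bij \<alpha>" "bij \<beta>" "bij \<gamma>"
    and e: "\<And>x y. G (\<alpha> x) (\<beta> y) = \<gamma> (F x y)"
    using assms(1) by (auto simp: isotopic_ops_def)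
  show ?thesis
    unfolding cyclic_def
    by (rule exI[of _ "\<alpha> \<circ> a"], rule exI[of _ "\<beta> \<circ> b"], rule exI[of _ "\<gamma> \<circ> c"])
      (use F b in \<open>auto simp: e intro: bij_betw_trans\<close>)
qed

section \<open>Fields with four elements\<close>

context
  assumes card4: "card (UNIV :: 'a::field set) = 4"
begin

lemma finite_field: "finite (UNIV :: 'a set)"
  using card4 card.infinite by fastforce

text \<open>Translation by 1 permutes the field, so summing all elements before and after it shows
  that four times 1 is 0.\<close>

lemma two_eq_0: "(2 :: 'a) = 0"
proof -
  have "(\<Sum>x\<in>UNIV. x + 1 :: 'a) = (\<Sum>x\<in>UNIV. x)"
    by (intro sum.reindex_bij_witness[of _ "\<lambda>x. x - 1" "\<lambda>x. x + 1"]) auto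
  then have "(of_nat (card (UNIV :: 'a set)) :: 'a) = 0"
    by (simp add: sum.distrib)
  then have "(2 :: 'a) * 2 = 0"
    by (simp add: card4)
  then show ?thesis
    using mult_eq_0_iff by blast
qed

lemma add_self [simp]: "x + x = (0 :: 'a)"
  by (metis mult_2 mult_zero_left two_eq_0)

lemma minus_eq [simp]: "- x = (x :: 'a)"
  by (metis add_self minus_unique)

lemma add_eq_0 [simp]: "x + y = 0 \<longleftrightarrow> x = (y :: 'a)"
  by (metis add_eq_0_iff minus_eq)

lemma add_self_left [simp]: "x + (x + y) = (y :: 'a)"
  by (simp flip: add.assoc)

lemma four_elements:
  assumes "distinct [a, b, c, d :: 'a]"
  shows "UNIV = {a, b, c, d}"
  using finite_field assms card4 by (intro card_subset_eq[symmetric]) auto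

text \<open>Any \<open>w\<close> other than 0 and 1 will do: \<open>w * w\<close> cannot be 0, 1 or
  \<open>w\<close>, which leaves \<open>w + 1\<close>. The value 1 is excluded because
  \<open>(w + 1) * (w + 1)\<close> would then vanish.\<close>

lemma generator:
  obtains w :: 'a where "w \<noteq> 0" "w \<noteq> 1" "w * w = w + 1" "UNIV = {0, 1, w, w + 1}"
    "distinct [0, 1, w, w + 1]"
proof -
  have "{0, 1 :: 'a} \<noteq> UNIV"
  proof
    assume *: "{0, 1 :: 'a} = UNIV"
    show False
      using card4 unfolding *[symmetric] by simp
  qed
  then obtain w :: 'a where w: "w \<noteq> 0" "w \<noteq> 1"
    by blast
  then have d: "distinct [0, 1, w, w + 1]"
    using add_eq_0[of w 1] by (auto simp del: add_eq_0)
  note U = four_elements[OF d]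
  have "w * w \<noteq> 1"
  proof
    assume "w * w = 1"
    then have "(w + 1) * (w + 1) = 0"
      by (simp add: algebra_simps)
    with w show False by simp
  qed
  moreover have "w * w \<noteq> 0" "w * w \<noteq> w"
    using w by auto
  moreover have "w * w \<in> {0, 1, w, w + 1}"
    using U by blast
  ultimately have "w * w = w + 1"
    by blast
  with that w U d show thesis by blast
qed

lemma power4_eq [simp]: "x ^ 4 = (x :: 'a)"
proof -
  obtain w :: 'a where w: "w * w = w + 1" "UNIV = {0, 1, w, w + 1}"
    using generator by metis
  have e: "x ^ 4 = (x * x) * (x * x)"
    by (simp add: eval_nat_numeral)
  have "x \<in> {0, 1, w, w + 1}"
    using w by blast
  then show ?thesis
    unfolding e by (auto simp: w algebra_simps)
qed

text \<open>A bijection only reorders the sum of all field elements, which is 0 + 1 +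
  \<open>w\<close> + (\<open>w\<close> + 1) = 0.\<close>

lemma sum_bij_eq_0:
  fixes g :: "'a \<Rightarrow> 'a"
  assumes "bij g"
  shows "(\<Sum>x\<in>UNIV. g x) = 0"
proof -
  obtain w :: 'a where w: "UNIV = {0, 1, w, w + 1}" "distinct [0, 1, w, w + 1]"
    using generator by metis
  have "(\<Sum>x\<in>UNIV. g x) = (\<Sum>x\<in>UNIV. x)"
    using assms by (rule sum.reindex_bij_betw)
  also have "\<dots> = 0"
    unfolding w(1) using w(2) by (simp add: ac_simps)
  finally show ?thesis .
qed

section \<open>Reduced polynomials, interpolation and the ideal of vanishing polynomials\<close>

lemma poly_eq_0I:
  fixes p :: "'a poly"
  assumes "degree p < 4" "\<And>x. poly p x = 0"
  shows "p = 0"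
  using assms by (intro poly_eqI_degree[of UNIV]) (auto simp: card4)

lemma cubic_eq_0:
  fixes c0 c1 c2 c3 :: 'a
  assumes "\<And>x. c0 + c1 * x + c2 * x ^ 2 + c3 * x ^ 3 = 0"
  shows "c0 = 0" "c1 = 0" "c2 = 0" "c3 = 0"
proof -
  have "[:c0, c1, c2, c3:] = 0"
  proof (rule poly_eq_0I)
    fix x
    show "poly [:c0, c1, c2, c3:] x = 0"
      using assms[of x] by (simp add: algebra_simps eval_nat_numeral)
  qed simp
  then show "c0 = 0" "c1 = 0" "c2 = 0" "c3 = 0"
    by simp_all
qed

lemma interpolate:
  fixes g :: "'a \<Rightarrow> 'a"
  obtains p where "degree p < 4" "poly p = g"
proof
  \<comment> \<open>Lagrange basis: the factors are (x - b)/(a - b), so \<open>L a\<close> is 1 at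
    \<open>a\<close> and 0 elsewhere.\<close>
  define L :: "'a \<Rightarrow> 'a poly" where
    "L = (\<lambda>a. \<Prod>b\<in>UNIV - {a}. [:- b * inverse (a - b), inverse (a - b):])"
  define p where "p = (\<Sum>a\<in>UNIV. smult (g a) (L a))"
  have dL: "degree (L a) \<le> 3" for a
  proof -
    have "degree (L a) \<le> (\<Sum>b\<in>UNIV - {a}. degree [:- b * inverse (a - b), inverse (a - b):])"
      unfolding L_def by (rule degree_prod_sum_le[OF finite_subset[OF subset_UNIV finite_field], unfolded o_def])
    also have "\<dots> \<le> (\<Sum>b\<in>UNIV - {a}. 1)"
      by (intro sum_mono) auto
    also have "\<dots> = 3"
      using finite_field by (simp add: card4 card_Diff_singleton)
    finally show ?thesis .
  qed
  have "degree p \<le> 3"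
    unfolding p_def using dL by (intro degree_sum_le finite_field) (meson degree_smult_le order_trans)
  then show "degree p < 4" by simp
  have *: "poly (L a) x = (if x = a then 1 else 0)" for a x
  proof -
    have "poly (L a) x = (\<Prod>b\<in>UNIV - {a}. (x - b) * inverse (a - b))"
      unfolding L_def poly_prod by (intro prod.cong) (auto simp: algebra_simps)
    also have "\<dots> = (if x = a then 1 else 0)"
      using finite_field by (auto simp del: minus_eq intro!: prod.neutral prod_zero)
    finally show ?thesis .
  qed
  show "poly p = g"
    using finite_field by (auto simp: p_def poly_sum * if_distrib[of "times _"] sum.delta cong: if_cong)
qed

text \<open>The remainder modulo x^4 - x still vanishes on the whole field, and its degree is too
  small for four zeros.\<close>

lemma vanishing_dvd:
  fixes p :: "'a poly"
  assumes "\<And>x. poly p x = 0"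
  shows "[:0, 1:] ^ 4 - [:0, 1:] dvd p"
proof -
  let ?m = "[:0, 1:] ^ 4 - [:0, 1 :: 'a:]"
  have m: "?m = [:0, - 1, 0, 0, 1:]"
    by (simp add: eval_nat_numeral)
  have "p mod ?m = 0"
  proof (rule poly_eq_0I)
    show "degree (p mod ?m) < 4"
      using degree_mod_less[of ?m p] by (auto simp: m)
  next
    fix x
    have "poly p x = poly (p div ?m * ?m + p mod ?m) x"
      by (simp only: div_mult_mod_eq)
    then show "poly (p mod ?m) x = 0"
      using assms by simp
  qed
  then show ?thesis by (simp add: dvd_eq_mod_eq_0)
qed

text \<open>Reduce modulo y^4 - y first. For each fixed x the remainder is the zero polynomial in y,
  so its coefficients vanish as functions of x and are divisible by x^4 - x.\<close>

lemma vanishing_cong4: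
  fixes f :: "'a poly poly"
  assumes van: "\<And>a b. ev f a b = 0"
  shows "\<exists>A B. f = A * (var_x ^ 4 - var_x) + B * (var_y ^ 4 - var_y)"
proof -
  let ?m = "var_y ^ 4 - var_y :: 'a poly poly"
  have m: "?m = [:0, - 1, 0, 0, 1:]"
    by (simp add: eval_nat_numeral var_y_def)
  \<comment> \<open>The coefficients are polynomials in x and form no field, hence pseudo-division;
    the divisor is monic, so it amounts to ordinary division.\<close>
  obtain B r where Br: "pseudo_divmod f ?m = (B, r)"
    by force
  have "?m \<noteq> 0" by (simp add: m)
  note d = pseudo_divmod[OF this Br]
  have f: "f = ?m * B + r"
    using d(1) by (simp add: m)
  have deg: "degree r < 4"
    using d(2) by (auto simp: m)
  have evr: "ev r a b = 0" for a b
    using van[of a b] by (simp add: f)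
  have "poly (coeff r j) a = 0" for a j
  proof -
    have "subst_x a r = 0"
    proof (rule poly_eq_0I)
      show "degree (subst_x a r) < 4"
        unfolding subst_x_def using deg map_poly_degree_leq le_less_trans by blast
    qed (simp add: poly_subst_x evr)
    then have "coeff (subst_x a r) j = 0" by simp
    then show ?thesis by (simp add: subst_x_def coeff_map_poly)
  qed
  then have "[:[:0, 1:] ^ 4 - [:0, 1:]:] dvd r"
    unfolding const_poly_dvd_iff using vanishing_dvd by blast
  moreover have "[:[:0, 1:] ^ 4 - [:0, 1:]:] = (var_x ^ 4 - var_x :: 'a poly poly)"
    by (simp add: var_x_def eval_nat_numeral)
  ultimately obtain A where "r = (var_x ^ 4 - var_x) * A"
    by (auto simp: dvd_def)
  with f show ?thesis
    by (metis add.commute mult.commute)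
qed

lemma cong4_iff: "cong4 f g \<longleftrightarrow> ev f = (ev g :: 'a \<Rightarrow> _)"
proof
  assume "cong4 f g"
  then obtain A B where *: "f - g = A * (var_x ^ 4 - var_x) + B * (var_y ^ 4 - var_y)"
    by (auto simp: cong4_def)
  have "ev f a b = ev g a b" for a b
    using arg_cong[OF *, of "\<lambda>h. ev h a b"] by simp
  then show "ev f = ev g" by blast
next
  assume "ev f = ev g"
  then show "cong4 f g"
    unfolding cong4_def by (intro vanishing_cong4) simp
qed

text \<open>Congruence is equality of the induced operations, and interpolation realises every
  bijection of the field by an element of \<open>P4\<close>.\<close>

lemma isotopic_iff: "isotopic f g \<longleftrightarrow> isotopic_ops (ev f) (ev (g :: 'a poly poly))"
proof
  assume "isotopic f g"
  then obtain h1 h2 h3 where "h1 \<in> P4" "h2 \<in> P4" "h3 \<in> P4"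
    and "cong4 (compose_in g h1 h2) (compose_out h3 f)"
    by (auto simp: isotopic_def)
  then have "ev g (poly h1 x) (poly h2 y) = poly h3 (ev f x y)" for x y
    by (simp add: cong4_iff flip: ev_compose_in ev_compose_out)
  with \<open>h1 \<in> P4\<close> \<open>h2 \<in> P4\<close> \<open>h3 \<in> P4\<close> show "isotopic_ops (ev f) (ev g)"
    unfolding isotopic_ops_def P4_def permutation_poly_def by blast
next
  assume "isotopic_ops (ev f) (ev g)"
  then obtain \<alpha> \<beta> \<gamma> where b: "bij \<alpha>" "bij \<beta>" "bij \<gamma>"
    and e: "\<And>x y. ev g (\<alpha> x) (\<beta> y) = \<gamma> (ev f x y)"
    by (auto simp: isotopic_ops_def)
  obtain h1 h2 h3 where h: "degree h1 < 4" "poly h1 = \<alpha>" "degree h2 < 4" "poly h2 = \<beta>"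
    "degree h3 < 4" "poly h3 = \<gamma>"
    using interpolate by metis
  have "cong4 (compose_in g h1 h2) (compose_out h3 f)"
    by (simp add: cong4_iff fun_eq_iff ev_compose_in ev_compose_out h e)
  with b h show "isotopic f g"
    unfolding isotopic_def P4_def permutation_poly_def by blast
qed


section \<open>Coefficients of local permutation polynomials\<close>

text \<open>Over the four elements the powers x^0, x^1, x^2 sum to 0 and x^3 sums to 1, so the
  values of the cubic sum to \<open>c3\<close>.\<close>

lemma bij_cubicD:
  fixes c0 c1 c2 c3 :: 'a
  assumes "bij (\<lambda>x. c0 + c1 * x + c2 * x ^ 2 + c3 * x ^ 3)"
  shows "c3 = 0"
proof -
  obtain w :: 'a where w: "w * w = w + 1" "UNIV = {0, 1, w, w + 1}" "distinct [0, 1, w, w + 1]"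
    using generator by metis
  have "w ^ 2 = w + 1" "w ^ 3 = 1" "(w + 1) ^ 2 = w" "(w + 1) ^ 3 = 1"
    by (simp_all add: eval_nat_numeral algebra_simps w(1))
  then have "(\<Sum>x\<in>UNIV. c0 + c1 * x + c2 * x ^ 2 + c3 * x ^ 3) = c3"
    unfolding w(2) using w(3) by (simp add: algebra_simps)
  then show ?thesis
    using sum_bij_eq_0[OF assms] by simp
qed

lemma square_add: "(x + y) ^ 2 = x ^ 2 + (y :: 'a) ^ 2"
  by (simp add: power2_sum two_eq_0)

text \<open>By additivity of squaring, c1 x + c2 x^2 is an additive map, so injectivity means that 0
  is its only zero. If both coefficients are nonzero, \<open>c1 / c2\<close> is another
  zero.\<close>

lemma bij_quadratic_iff:
  fixes c0 c1 c2 :: 'a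
  shows "bij (\<lambda>x. c0 + c1 * x + c2 * x ^ 2) \<longleftrightarrow> (c1 = 0 \<longleftrightarrow> c2 \<noteq> 0)" (is "bij ?f \<longleftrightarrow> _")
proof
  assume "bij ?f"
  then have "inj ?f"
    by (rule bij_is_inj)
  note inj = injD[OF this]
  have "\<not> (c1 = 0 \<and> c2 = 0)"
    using inj[of 0 1] by (metis mult_zero_left zero_neq_one)
  moreover have "\<not> (c1 \<noteq> 0 \<and> c2 \<noteq> 0)"
  proof
    assume c: "c1 \<noteq> 0 \<and> c2 \<noteq> 0"
    then have "c1 * (c1 / c2) + c2 * (c1 / c2) ^ 2 = 0"
      by (simp add: power2_eq_square)
    with inj[of "c1 / c2" 0] have "c1 / c2 = 0"
      by (simp add: add.assoc del: add_eq_0)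
    with c show False by simp
  qed
  ultimately show "c1 = 0 \<longleftrightarrow> c2 \<noteq> 0" by blast
next
  assume c: "c1 = 0 \<longleftrightarrow> c2 \<noteq> 0"
  have "inj ?f"
  proof
    fix x y assume "?f x = ?f y"
    then have "?f x + ?f y = 0"
      by (simp only: add_self)
    also have "?f x + ?f y = (c0 + c0) + (c1 * (x + y) + c2 * (x + y) ^ 2)"
      unfolding square_add distrib_left by (simp only: ac_simps)
    finally have "c1 * (x + y) = c2 * (x + y) ^ 2"
      by simp
    with c show "x = y" by (cases "c1 = 0") auto
  qed
  then show "bij ?f"
    by (rule bij_if_inj_finite[OF finite_field])
qed

text \<open>Otherwise the quadratic would have three zeros without vanishing identically.\<close>

lemma constant_if_complementary_supports:
  fixes u0 u1 u2 v0 v1 :: 'a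
  assumes "\<And>y. u0 + u1 * y + u2 * y ^ 2 = 0 \<longleftrightarrow> v0 + v1 * y \<noteq> 0"
  shows "v1 = 0"
proof (rule ccontr)
  assume v1: "v1 \<noteq> 0"
  define z where "z = v0 / v1"
  have v: "v0 + v1 * y = 0 \<longleftrightarrow> y = z" for y
    using v1 by (auto simp: z_def field_simps)
  \<comment> \<open>This cubic is the quadratic times \<open>y + z\<close>: away from
    \<open>z\<close> the quadratic vanishes, at \<open>z\<close> the other factor does.\<close>
  have "u0 * z + (u0 + u1 * z) * y + (u1 + u2 * z) * y ^ 2 + u2 * y ^ 3 = 0" for y
  proof -
    have "u0 * z + (u0 + u1 * z) * y + (u1 + u2 * z) * y ^ 2 + u2 * y ^ 3
      = (u0 + u1 * y + u2 * y ^ 2) * (y + z)"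
      by (simp add: algebra_simps eval_nat_numeral)
    also have "\<dots> = 0"
      using assms[of y] v[of y] by auto
    finally show ?thesis .
  qed
  from cubic_eq_0[OF this] have "u0 = 0" "u1 = 0" "u2 = 0"
    by auto
  then show False
    using assms[of z] v[of z] by simp
qed

text \<open>With one variable fixed, the cubic coefficient in the other is 0. As a function of the
  fixed variable it is itself a cubic that vanishes everywhere, so all its coefficients are
  0.\<close>

lemma LP4_coeff_3:
  fixes f :: "'a poly poly"
  assumes "f \<in> LP4"
  shows "coef f 3 j = 0" "coef f i 3 = 0"
proof -
  define c where "c = coef f"
  have deg: "degree f < 4" "\<And>j. degree (coeff f j) < 4" and L: "latin (ev f)"
    using assms by (auto simp: LP4_iff)
  have E: "ev f x y = (\<Sum>j<4. (\<Sum>i<4. c i j * x ^ i) * y ^ j)" for x y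
    using ev_expand4[OF deg] by (simp add: c_def coef_def)
  have large: "c i j = 0" if "i \<ge> 4 \<or> j \<ge> 4" for i j
    using that deg(1) deg(2)[of j] by (auto simp: c_def coef_def coeff_eq_0)
  have all: "\<forall>i. d i = 0" if "d 0 = 0" "d 1 = 0" "d 2 = 0" "d 3 = 0" "\<And>i. i \<ge> 4 \<Longrightarrow> d i = 0"
    for d :: "nat \<Rightarrow> 'a"
  proof
    fix i show "d i = 0"
    proof (cases "i \<ge> 4")
      case False
      then have "i = 0 \<or> i = 1 \<or> i = 2 \<or> i = 3"
        by linarith
      then show ?thesis
        using that(1-4) by (elim disjE) simp_all
    qed (rule that(5))
  qed
  have "c 3 0 + c 3 1 * y + c 3 2 * y ^ 2 + c 3 3 * y ^ 3 = 0" for y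
  proof (rule bij_cubicD)
    let ?r = "\<lambda>i. c i 0 + c i 1 * y + c i 2 * y ^ 2 + c i 3 * y ^ 3"
    have "bij (\<lambda>x. ev f x y)"
      using L by (simp add: latin_def)
    also have "(\<lambda>x. ev f x y) = (\<lambda>x. ?r 0 + ?r 1 * x + ?r 2 * x ^ 2 + ?r 3 * x ^ 3)"
      by (intro ext) (simp add: E numeral_eq_Suc algebra_simps)
    finally show "bij (\<lambda>x. ?r 0 + ?r 1 * x + ?r 2 * x ^ 2 + ?r 3 * x ^ 3)" .
  qed
  from cubic_eq_0[OF this] all[of "c 3"] large show "coef f 3 j = 0"
    by (simp add: c_def)
  have "c 0 3 + c 1 3 * x + c 2 3 * x ^ 2 + c 3 3 * x ^ 3 = 0" for x
  proof (rule bij_cubicD)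
    let ?r = "\<lambda>j. c 0 j + c 1 j * x + c 2 j * x ^ 2 + c 3 j * x ^ 3"
    have "bij (ev f x)"
      using L by (simp add: latin_def)
    also have "ev f x = (\<lambda>y. ?r 0 + ?r 1 * y + ?r 2 * y ^ 2 + ?r 3 * y ^ 3)"
      by (intro ext) (simp add: E numeral_eq_Suc algebra_simps)
    finally show "bij (\<lambda>y. ?r 0 + ?r 1 * y + ?r 2 * y ^ 2 + ?r 3 * y ^ 3)" .
  qed
  from cubic_eq_0[OF this] all[of "\<lambda>i. c i 3"] large show "coef f i 3 = 0"
    by (simp add: c_def)
qed

lemma LP4_coeff_eq_0:
  fixes f :: "'a poly poly"
  assumes "f \<in> LP4" "coef f i j \<noteq> 0"
  shows "i \<le> 2" "j \<le> 2"
proof -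
  have "degree f < 4" "degree (coeff f j) < 4"
    using assms by (auto simp: LP4_iff)
  with assms(2) have "i < 4" "j < 4"
    unfolding coef_def by (metis le_degree le_less_trans, metis coeff_0 le_degree le_less_trans)
  moreover have "i \<noteq> 3" "j \<noteq> 3"
    using LP4_coeff_3[OF assms(1)] assms(2) by metis+
  ultimately show "i \<le> 2" "j \<le> 2"
    by simp_all
qed

lemma LP4_ev:
  fixes f :: "'a poly poly"
  defines "c \<equiv> coef f"
  assumes "f \<in> LP4"
  shows "ev f x y = (c 0 0 + c 0 1 * y + c 0 2 * y ^ 2)
    + (c 1 0 + c 1 1 * y + c 1 2 * y ^ 2) * x
    + (c 2 0 + c 2 1 * y + c 2 2 * y ^ 2) * x ^ 2"
proof -
  have "degree f < 4" "\<And>j. degree (coeff f j) < 4"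
    using assms by (auto simp: LP4_iff)
  from ev_expand4[OF this] LP4_coeff_3[OF assms(2)] show ?thesis
    by (simp add: c_def coef_def numeral_eq_Suc algebra_simps)
qed

text \<open>For every y exactly one of the coefficients of x and x^2 is zero, and likewise with the
  variables exchanged. If \<open>c 2 2 = 0\<close>, the coefficient of x^2 is at most linear in y,
  so it is constant; by symmetry so is that of y^2 in x.\<close>

lemma LP4_coeff_22_eq_0:
  fixes f :: "'a poly poly"
  defines "c \<equiv> coef f"
  assumes "f \<in> LP4" "c 2 2 = 0"
  shows "c 1 1 = 0" "c 1 2 = 0" "c 2 1 = 0" "c 1 0 = 0 \<longleftrightarrow> c 2 0 \<noteq> 0"
proof -
  note E = LP4_ev[OF assms(2), folded c_def]
  have L: "latin (ev f)"
    using assms(2) by (simp add: LP4_iff)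
  have x: "c 1 0 + c 1 1 * y + c 1 2 * y ^ 2 = 0 \<longleftrightarrow> c 2 0 + c 2 1 * y + c 2 2 * y ^ 2 \<noteq> 0" for y
    using L unfolding latin_def E bij_quadratic_iff by blast
  have y: "c 0 1 + c 1 1 * x + c 2 1 * x ^ 2 = 0 \<longleftrightarrow> c 0 2 + c 1 2 * x + c 2 2 * x ^ 2 \<noteq> 0" for x
  proof -
    have "bij (ev f x)"
      using L by (simp add: latin_def)
    also have "ev f x = (\<lambda>y. (c 0 0 + c 1 0 * x + c 2 0 * x ^ 2)
      + (c 0 1 + c 1 1 * x + c 2 1 * x ^ 2) * y + (c 0 2 + c 1 2 * x + c 2 2 * x ^ 2) * y ^ 2)"
      by (intro ext) (simp add: E algebra_simps)
    finally show ?thesis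
      by (simp only: bij_quadratic_iff)
  qed
  show c21: "c 2 1 = 0"
    using x assms(3) by (intro constant_if_complementary_supports) simp
  show c12: "c 1 2 = 0"
    using y assms(3) by (intro constant_if_complementary_supports) simp
  \<comment> \<open>Once \<open>c 1 2 = 0\<close>, the coefficient of x is at most linear in y and
    takes the linear role.\<close>
  show "c 1 1 = 0"
  proof (rule constant_if_complementary_supports)
    fix y show "c 2 0 + c 2 1 * y + c 2 2 * y ^ 2 = 0 \<longleftrightarrow> c 1 0 + c 1 1 * y \<noteq> 0"
      using x[of y] c12 by auto
  qed
  show "c 1 0 = 0 \<longleftrightarrow> c 2 0 \<noteq> 0"
    using x[of 0] by simp
qed

lemma LP4_separated_iff:
  fixes f :: "'a poly poly"
  assumes "f \<in> LP4"
  shows "separated (ev f) \<longleftrightarrow> coef f 2 2 = 0"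
proof -
  define c where "c = coef f"
  note E = LP4_ev[OF assms, folded c_def]
  have "separated (ev f) \<longleftrightarrow> c 2 2 = 0"
  proof
    assume "separated (ev f)"
    \<comment> \<open>In characteristic two this sum is the mixed second difference; only terms
      containing both variables survive in it.\<close>
    then have s: "ev f x y + ev f x 0 + ev f 0 y + ev f 0 0 = 0" for x y
      by (auto simp: separated_def ac_simps)
    \<comment> \<open>Padded to a cubic in x; its x^2 coefficient is then read as a cubic in y to
      isolate \<open>c 2 2\<close>.\<close>
    have "0 + (c 1 1 * y + c 1 2 * y ^ 2) * x + (c 2 1 * y + c 2 2 * y ^ 2) * x ^ 2 + 0 * x ^ 3 = 0" for x y
      using s[of x y] unfolding E by (simp add: algebra_simps)
    from cubic_eq_0(3)[OF this] have "0 + c 2 1 * y + c 2 2 * y ^ 2 + 0 * y ^ 3 = 0" for y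
      by simp
    from cubic_eq_0(3)[OF this] show "c 2 2 = 0" .
  next
    assume "c 2 2 = 0"
    then have "ev f x y = (c 0 0 + c 1 0 * x + c 2 0 * x ^ 2) + (c 0 1 * y + c 0 2 * y ^ 2)" for x y
      using LP4_coeff_22_eq_0[OF assms] by (simp add: E c_def)
    then show "separated (ev f)"
      unfolding separated_def by (intro exI allI) assumption
  qed
  then show ?thesis by (simp add: c_def)
qed

text \<open>Both exponents are at most 2, so total degree 4 means that x^2 y^2 occurs. Without it no
  mixed term is left, and one of the terms x and x^2 does occur.\<close>

lemma LP4_total_degree:
  fixes f :: "'a poly poly"
  assumes "f \<in> LP4"
  shows "if separated (ev f) then total_degree f \<in> {1, 2} else total_degree f = 4"
proof -
  define S where "S = insert 0 {i + j |i j. coef f i j \<noteq> 0}"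
  have td: "total_degree f = Max S"
    by (simp add: total_degree_def S_def coef_def)
  have S4: "S \<subseteq> {..4}"
    using LP4_coeff_eq_0[OF assms] by (fastforce simp: S_def)
  then have finS: "finite S"
    by (rule finite_subset) simp
  have mem: "i + j \<in> S" if "coef f i j \<noteq> 0" for i j
    using that by (auto simp: S_def)
  show ?thesis
  proof (cases "coef f 2 2 = 0")
    case True
    note z = LP4_coeff_22_eq_0[OF assms True]
    have "S \<subseteq> {..2}"
    proof
      fix n assume "n \<in> S"
      then consider "n = 0" | i j where "n = i + j" "coef f i j \<noteq> 0"
        by (auto simp: S_def)
      then show "n \<in> {..2}"
      proof cases
        case 2
        then have "i \<le> 2" "j \<le> 2"
          using LP4_coeff_eq_0[OF assms] by blast+
        then consider "i = 0" | "j = 0" | "i = 1" "j = 1" | "i = 1" "j = 2" | "i = 2" "j = 1"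
          | "i = 2" "j = 2"
          by linarith
        then show ?thesis
          using 2 z True \<open>i \<le> 2\<close> \<open>j \<le> 2\<close> by cases auto
      qed simp
    qed
    moreover have "\<exists>n\<in>S. n \<ge> 1"
      using z(4) mem[of 1 0] mem[of 2 0] by fastforce
    ultimately have "Max S \<le> 2" "Max S \<ge> 1"
      using finS by (auto simp: S_def Max_ge_iff)
    then show ?thesis
      using LP4_separated_iff[OF assms] True td by auto
  next
    case False
    then have "Max S = 4"
      using S4 mem[of 2 2] finS by (intro Max_eqI) auto
    then show ?thesis
      using LP4_separated_iff[OF assms] False td by auto
  qed
qed

lemma LP4_deg_eq:
  "LP4_deg 1 \<union> LP4_deg 2 = {f \<in> LP4. separated (ev f :: 'a \<Rightarrow> _)}"
  "LP4_deg 4 = {f \<in> LP4. \<not> separated (ev f :: 'a \<Rightarrow> _)}"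
  using LP4_total_degree by (fastforce simp: LP4_deg_def split: if_splits)+


section \<open>Latin squares of order 4\<close>

text \<open>If 0, \<open>x\<close>, \<open>y\<close>, \<open>x + y\<close> are distinct, they
  exhaust the field and their images sum to 0. The remaining cases hold by cancellation in
  characteristic two.\<close>

lemma bij_add:
  fixes g :: "'a \<Rightarrow> 'a"
  assumes "bij g"
  shows "g (x + y) = g x + g y + g 0"
proof (cases "x = 0 \<or> y = 0 \<or> x = y")
  case True
  then show ?thesis by (auto simp: ac_simps)
next
  case False
  then have d: "distinct [0, x, y, x + y]"
    using add_eq_0[of x y] by (auto simp del: add_eq_0)
  have "g 0 + (g x + (g y + g (x + y))) = 0"
    using sum_bij_eq_0[OF assms] d unfolding four_elements[OF d] by simp
  then have "g (x + y) + (g x + g y + g 0) = 0"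
    by (simp only: ac_simps)
  then show ?thesis
    by (simp only: add_eq_0)
qed

lemma separated_if_isotopic_plus:
  fixes F :: "'a \<Rightarrow> 'a \<Rightarrow> 'a"
  assumes "isotopic_ops (+) F"
  shows "separated F"
proof -
  obtain \<alpha> \<beta> \<gamma> :: "'a \<Rightarrow> 'a" where b: "bij \<alpha>" "bij \<beta>" "bij \<gamma>"
    and e: "\<And>x y. F (\<alpha> x) (\<beta> y) = \<gamma> (x + y)"
    using assms by (auto simp: isotopic_ops_def)
  have "F x y = \<gamma> (inv \<alpha> x) + (\<gamma> (inv \<beta> y) + \<gamma> 0)" for x y
  proof -
    have "F x y = F (\<alpha> (inv \<alpha> x)) (\<beta> (inv \<beta> y))"
      using b by (simp add: bij_is_surj surj_f_inv_f)
    also have "\<dots> = \<gamma> (inv \<alpha> x + inv \<beta> y)"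
      by (rule e)
    also have "\<dots> = \<gamma> (inv \<alpha> x) + \<gamma> (inv \<beta> y) + \<gamma> 0"
      by (rule bij_add[OF b(3)])
    finally show ?thesis
      by (simp only: add.assoc)
  qed
  then show ?thesis
    unfolding separated_def by (intro exI allI) assumption
qed

text \<open>Row and column bijectivity makes \<open>A\<close> and \<open>B\<close> bijections up to
  a translation; they relabel rows and columns while the symbols stay fixed.\<close>

lemma isotopic_plus_if_separated:
  fixes F :: "'a \<Rightarrow> 'a \<Rightarrow> 'a"
  assumes "latin F" "separated F"
  shows "isotopic_ops F (+)"
proof -
  obtain A B where F: "\<And>x y. F x y = A x + B y"
    using assms(2) by (auto simp: separated_def)
  have "inj (\<lambda>x. A x + B 0)" "inj (\<lambda>y. A 0 + B y)"
    using assms(1) by (simp_all add: latin_def bij_def flip: F)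
  then have "inj A" "inj B"
    unfolding inj_def add_right_cancel add_left_cancel by blast+
  then have "bij A" "bij B"
    by (simp_all add: bij_if_inj_finite finite_field)
  then show ?thesis
    unfolding isotopic_ops_def using F by (metis bij_id id_apply)
qed

section \<open>Normalised Latin squares and their two possible tables\<close>

lemma cyclic_table:
  fixes F :: "'a \<Rightarrow> 'a \<Rightarrow> 'a"
  assumes "latin F" and row: "\<And>x. F x 0 = x" and col: "\<And>y. F 0 y = y"
    and p: "p \<noteq> 0" "F p p \<noteq> 0"
  shows "cyclic F"
proof -
  define q where "q = F p p"
  have inj: "F x y = F x z \<longleftrightarrow> y = z" "F y x = F z x \<longleftrightarrow> y = z" for x y z
    using assms(1) unfolding latin_def by (metis bij_is_inj injD)+
  have "q \<noteq> p"
    using inj(1)[of p p 0] p by (simp add: row q_def)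
  \<comment> \<open>The sum serves only to name the fourth element.\<close>
  define r where "r = p + q"
  have r: "r \<noteq> 0" "r \<noteq> p" "r \<noteq> q"
    using \<open>q \<noteq> p\<close> p by (auto simp: r_def q_def)
  have d: "distinct [0, p, q, r]"
    using p \<open>q \<noteq> p\<close> r by (auto simp: q_def)
  have U: "x = 0 \<or> x = p \<or> x = q \<or> x = r" for x
    using four_elements[OF d] by blast
  have neq: "y \<noteq> 0 \<Longrightarrow> F x y \<noteq> x" "y \<noteq> 0 \<Longrightarrow> F y x \<noteq> x" for x y
    using inj(1)[of x y 0] inj(2)[of y x 0] by (simp_all add: row col)
  have n: "F x y \<noteq> F x z" "F y x \<noteq> F z x" if "y \<noteq> z" for x y z
    using that inj by simp_all
  have pp: "F p p = q" by (simp add: q_def)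
  \<comment> \<open>From here each entry is the one value left by three already placed in its row or
    column; the order of the entries matters.\<close>
  have pr: "F p r = 0"
    using U[of "F p r"] neq(1)[of r p] neq(2)[of p r] n(1)[of r p p] pp d by auto
  have rp: "F r p = 0"
    using U[of "F r p"] neq(1)[of p r] neq(2)[of r p] n(2)[of r p p] pp d by auto
  have pq: "F p q = r"
    using U[of "F p q"] neq(1)[of q p] neq(2)[of p q] n(1)[of q r p] pr d by auto
  have qp: "F q p = r"
    using U[of "F q p"] neq(1)[of p q] neq(2)[of q p] n(2)[of q r p] rp d by auto
  have qr: "F q r = p"
    using U[of "F q r"] neq(1)[of r q] neq(2)[of q r] n(2)[of q p r] pr d by auto
  have rq: "F r q = p"
    using U[of "F r q"] neq(1)[of q r] neq(2)[of r q] n(1)[of q p r] rp d by auto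
  have qq: "F q q = 0"
    using U[of "F q q"] neq(1)[of q q] n(1)[of q p q] n(1)[of q r q] qp qr d by auto
  have rr: "F r r = q"
    using U[of "F r r"] neq(1)[of r r] n(1)[of r p r] n(1)[of r q r] rp rq d by auto
  \<comment> \<open>The position in the list is the residue modulo 4, with \<open>p\<close> as
    generator.\<close>
  let ?a = "(!) [0, p, q, r]"
  have "bij_betw ?a {..<4} UNIV"
    using four_elements[OF d] by (intro bij_betw_nth[OF d]) auto
  moreover have "F (?a i) (?a j) = ?a ((i + j) mod 4)" if "i < 4" "j < 4" for i j
  proof -
    have "i = 0 \<or> i = 1 \<or> i = 2 \<or> i = 3" "j = 0 \<or> j = 1 \<or> j = 2 \<or> j = 3"
      using that by linarith+
    then show ?thesis
      by (elim disjE) (simp_all add: row col pp pq pr qp qq qr rp rq rr)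
  qed
  ultimately show ?thesis
    unfolding cyclic_def by blast
qed

text \<open>An entry off the diagonal and the borders differs from 0, \<open>x\<close> and
  \<open>y\<close>, all present in its row or column.\<close>

lemma plus_table:
  fixes F :: "'a \<Rightarrow> 'a \<Rightarrow> 'a"
  assumes "latin F" and row: "\<And>x. F x 0 = x" and col: "\<And>y. F 0 y = y"
    and sq: "\<And>x. F x x = 0"
  shows "F x y = x + y"
proof (cases "x = 0 \<or> y = 0 \<or> x = y")
  case True
  then show ?thesis using assms by auto
next
  case False
  then have d: "distinct [0, x, y, x + y]"
    using add_eq_0[of x y] by (auto simp del: add_eq_0)
  have inj: "F x y = F x z \<longleftrightarrow> y = z" "F y x = F z x \<longleftrightarrow> y = z" for x y z
    using assms(1) unfolding latin_def by (metis bij_is_inj injD)+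
  have "F x y \<noteq> F x x" "F x y \<noteq> F x 0" "F x y \<noteq> F 0 y"
    using False by (auto simp: inj)
  then have "F x y \<noteq> 0" "F x y \<noteq> x" "F x y \<noteq> y"
    by (simp_all add: row col sq)
  moreover have "F x y \<in> {0, x, y, x + y}"
    using four_elements[OF d] by blast
  ultimately show ?thesis by blast
qed

lemma latin_reduce:
  fixes F :: "'a \<Rightarrow> 'a \<Rightarrow> 'a"
  assumes "latin F"
  obtains G where "latin G" "\<And>x. G x 0 = x" "\<And>y. G 0 y = y" "isotopic_ops G F"
proof -
  \<comment> \<open>\<open>\<gamma>\<close> renames symbols so that column 0 becomes the identity;
    \<open>\<beta>\<close> then reorders columns to do the same for row 0.\<close>
  define \<gamma> where "\<gamma> = (\<lambda>x. F x 0)"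
  define \<beta> where "\<beta> = inv \<gamma> \<circ> F 0"
  define G where "G = (\<lambda>x y. inv \<gamma> (F x (inv \<beta> y)))"
  have b\<gamma>: "bij \<gamma>" "bij (inv \<gamma>)"
    using assms by (simp_all add: latin_def \<gamma>_def bij_imp_bij_inv)
  then have "bij \<beta>"
    using assms by (simp add: latin_def \<beta>_def bij_comp)
  then have b\<beta>: "bij \<beta>" "bij (inv \<beta>)"
    by (simp_all add: bij_imp_bij_inv)
  have inv\<gamma>: "inv \<gamma> (\<gamma> x) = x" "\<gamma> (inv \<gamma> x) = x" for x
    using b\<gamma> by (simp_all add: bij_is_inj bij_is_surj surj_f_inv_f)
  have inv\<beta>: "inv \<beta> (\<beta> x) = x" "\<beta> (inv \<beta> x) = x" for x
    using b\<beta> by (simp_all add: bij_is_inj bij_is_surj surj_f_inv_f)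
  \<comment> \<open>The reordering fixes column 0, so the normalisation of that column
    survives.\<close>
  have "F 0 0 = \<gamma> 0" by (simp add: \<gamma>_def)
  then have "\<beta> 0 = 0"
    by (simp add: \<beta>_def inv\<gamma>)
  then have "inv \<beta> 0 = 0"
    using inv\<beta>(1)[of 0] by simp
  then have 1: "G x 0 = x" for x
    using inv\<gamma>(1)[of x] by (simp add: G_def \<gamma>_def)
  have 2: "G 0 y = y" for y
    using inv\<beta>(2)[of y] by (simp add: G_def \<beta>_def)
  have "bij (inv \<gamma> \<circ> F x \<circ> inv \<beta>)" "bij (inv \<gamma> \<circ> (\<lambda>x. F x (inv \<beta> y)))" for x y
    using b\<gamma> b\<beta> assms unfolding latin_def by (blast intro: bij_comp)+
  then have 3: "latin G"
    by (simp add: latin_def G_def comp_def)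
  have "F (id x) (inv \<beta> y) = \<gamma> (G x y)" for x y
    by (simp add: G_def inv\<gamma>)
  then have "isotopic_ops G F"
    unfolding isotopic_ops_def using b\<gamma> b\<beta> by (meson bij_id)
  with 1 2 3 show thesis
    by (intro that)
qed

lemma separated_or_cyclic:
  fixes F :: "'a \<Rightarrow> 'a \<Rightarrow> 'a"
  assumes "latin F"
  shows "separated F \<or> cyclic F"
proof -
  obtain G where G: "latin G" "\<And>x. G x 0 = x" "\<And>y. G 0 y = y" "isotopic_ops G F"
    using latin_reduce[OF assms] by metis
  show ?thesis
  proof (cases "\<exists>p. p \<noteq> 0 \<and> G p p \<noteq> 0")
    case True
    then show ?thesis
      using cyclic_table G cyclic_if_isotopic_ops by metis
  next
    case False
    then have "G x x = 0" for x
      using G(2) by (cases "x = 0") auto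
    then have "G = (+)"
      using plus_table[OF G(1-3)] by blast
    then show ?thesis
      using separated_if_isotopic_plus G(4) by blast
  qed
qed

text \<open>Separated squares are all isotopic to addition, the others are all cyclic, and whatever
  is isotopic to addition is separated.\<close>

lemma isotopic_ops_iff:
  fixes F G :: "'a \<Rightarrow> 'a \<Rightarrow> 'a"
  assumes "latin F" "latin G"
  shows "isotopic_ops F G \<longleftrightarrow> (separated F \<longleftrightarrow> separated G)"
proof -
  have "isotopic_ops F G" if "\<not> separated F" "\<not> separated G"
    using separated_or_cyclic cyclic_isotopic_ops assms that by blast
  then show ?thesis
    using separated_if_isotopic_plus isotopic_plus_if_separated assms
      isotopic_ops_sym isotopic_ops_trans by metis
qed

section \<open>Isotopism classes\<close>

text \<open>The polynomial is x + y.\<close>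

lemma separated_example:
  "[: [:0, 1:], [:1:] :] \<in> {f \<in> LP4. separated (ev f :: 'a \<Rightarrow> _)}"
proof -
  let ?f = "[: [:0, 1:], [:1 :: 'a:] :]"
  have e: "ev ?f x y = x + y" for x y
    by (simp add: ev_def)
  have "inj (\<lambda>x. x + y)" "inj ((+) y)" for y :: 'a
    by (simp_all add: inj_def)
  then have "latin (ev ?f)"
    unfolding latin_def e[abs_def] by (simp add: bij_if_inj_finite[OF finite_field])
  moreover have "degree (coeff ?f j) < 4" for j
    by (simp add: coeff_pCons split: nat.split)
  moreover have "separated (ev ?f)"
    unfolding separated_def e by (rule exI[of _ "\<lambda>x. x"])+ simp
  ultimately show ?thesis
    by (simp add: LP4_iff)
qed

text \<open>The polynomial is x + y + (x + x^2)(y + y^2).\<close>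

lemma nonseparated_example:
  "[: [:0, 1:], [:1, 1, 1:], [:0, 1, 1:] :] \<in> {f \<in> LP4. \<not> separated (ev f :: 'a \<Rightarrow> _)}"
proof -
  let ?f = "[: [:0, 1:], [:1, 1, 1:], [:0, 1, 1 :: 'a:] :]"
  have ey: "ev ?f x = (\<lambda>y. x + (1 + x + x ^ 2) * y + (x + x ^ 2) * y ^ 2)" for x
    by (intro ext) (simp add: ev_def algebra_simps eval_nat_numeral)
  have ex: "(\<lambda>x. ev ?f x y) = (\<lambda>x. y + (1 + y + y ^ 2) * x + (y + y ^ 2) * x ^ 2)" for y
    by (intro ext) (simp add: ev_def algebra_simps eval_nat_numeral)
  \<comment> \<open>The value x + x^2 is the trace of x, hence 0 or 1: its product with 1 + x + x^2
    is x + x^4 = 0.\<close>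
  have t: "1 + x + x ^ 2 = 0 \<longleftrightarrow> x + x ^ 2 \<noteq> 0" for x :: 'a
  proof -
    have "(x + x ^ 2) * (1 + (x + x ^ 2)) = (x + x ^ 4) + (x ^ 2 + x ^ 2) + (x ^ 3 + x ^ 3)"
      by (simp only: algebra_simps) (simp add: algebra_simps eval_nat_numeral)
    also have "\<dots> = 0"
      by (simp only: power4_eq add_self)
    finally have "x + x ^ 2 = 0 \<or> 1 + (x + x ^ 2) = 0"
      by (simp only: mult_eq_0_iff)
    moreover have "\<not> (x + x ^ 2 = 0 \<and> 1 + (x + x ^ 2) = 0)"
      by auto
    ultimately show ?thesis
      by (simp only: add.assoc) blast
  qed
  have "latin (ev ?f)"
    unfolding latin_def ex unfolding ey bij_quadratic_iff using t by blast
  moreover have "degree (coeff ?f j) < 4" for j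
    by (simp add: coeff_pCons split: nat.split)
  ultimately have "?f \<in> LP4"
    by (simp add: LP4_iff)
  moreover have "coef ?f 2 2 \<noteq> 0"
    by (simp add: coef_def numeral_eq_Suc)
  ultimately show ?thesis
    by (simp add: LP4_separated_iff)
qed

lemma isotopism_class:
  fixes f :: "'a poly poly"
  assumes "f \<in> LP4"
  shows "isotopism `` {f} = (if separated (ev f) then LP4_deg 1 \<union> LP4_deg 2 else LP4_deg 4)"
  using assms isotopic_ops_iff unfolding LP4_deg_eq isotopism_def
  by (auto simp: isotopic_iff LP4_iff)

end

theorem corollary4p1:
  assumes "card (UNIV :: 'a::field set) = 4"
  shows "(LP4 :: 'a poly poly set) // isotopism = {LP4_deg 1 \<union> LP4_deg 2, LP4_deg 4}
    \<and> (LP4_deg 1 \<union> LP4_deg 2 :: 'a poly poly set) \<noteq> LP4_deg 4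
    \<and> (LP4_deg 1 \<inter> LP4_deg 2 :: 'a poly poly set) = {}"
proof (intro conjI)
  let ?sep = "[: [:0, 1:], [:1:] :] :: 'a poly poly"
  let ?non = "[: [:0, 1:], [:1, 1, 1:], [:0, 1, 1:] :] :: 'a poly poly"
  have sep: "?sep \<in> LP4" "separated (ev ?sep)" and non: "?non \<in> LP4" "\<not> separated (ev ?non)"
    using separated_example[OF assms] nonseparated_example[OF assms] by simp_all
  have "(LP4 :: 'a poly poly set) // isotopism = (\<lambda>f. isotopism `` {f}) ` LP4"
    by (auto simp: quotient_def)
  also have "\<dots> = (\<lambda>f :: 'a poly poly. if separated (ev f) then LP4_deg 1 \<union> LP4_deg 2 else LP4_deg 4) ` LP4"
    by (intro image_cong refl isotopism_class[OF assms])
  \<comment> \<open>The two examples show that both values are attained.\<close>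
  also have "\<dots> = {LP4_deg 1 \<union> LP4_deg 2, LP4_deg 4}"
    using sep non by (auto simp: image_iff split: if_splits)
  finally show "(LP4 :: 'a poly poly set) // isotopism = {LP4_deg 1 \<union> LP4_deg 2, LP4_deg 4}" .
  show "(LP4_deg 1 \<union> LP4_deg 2 :: 'a poly poly set) \<noteq> LP4_deg 4"
    unfolding LP4_deg_eq[OF assms] using sep by blast
  show "(LP4_deg 1 \<inter> LP4_deg 2 :: 'a poly poly set) = {}"
    by (auto simp: LP4_deg_def)
qed

end
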